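(* For every positive integer $d$ and every real $\theta$, $$\cos(d\theta)=\frac{2^{d-1}}{d}\sum_{k=0}^{d-1}(-1)^k\cos^d\!\left(\theta-\frac{k\pi}{d}\right),\qquad \sin(d\theta)=\frac{2^{d-1}}{d}\sum_{k=0}^{d-1}(-1)^k\cos^d\!\left(\theta-\frac{2k+1}{2d}\pi\right).$$ Moreover, if $r$ is an integer with $\frac d3<r\le d$ and $d-r$ even, then for every real $\theta$, $$\cos(r\theta)=\frac{2^{d-1}}{r\binom{d}{\frac{d-r}{2}}}\sum_{k=0}^{r-1}(-1)^k\cos^d\!\left(\theta-\frac{k\pi}{r}\right),\qquad \sin(r\theta)=\frac{2^{d-1}}{r\binom{d}{\frac{d-r}{2}}}\sum_{k=0}^{r-1}(-1)^k\cos^d\!\left(\theta-\frac{2k+1}{2r}\pi\right).$$ *)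

theory Defs
  imports Complex_Main
begin

end

theory Submission imports Defs begin

text \<open>
  Expand \<open>cos\<^sup>d\<close> into the frequencies \<open>2j - d\<close>, \<open>j \<le> d\<close>. The alternating sum over the
  translates by multiples of \<open>\<pi> / r\<close> annihilates every frequency of the parity of \<open>r\<close> that is not
  an odd multiple of \<open>r\<close>, because it is then a full sum over nontrivial roots of unity. As
  \<open>d < 3r\<close>, only the frequencies \<open>\<plusminus>r\<close> survive. The sine formula is the cosine formula
  at \<open>\<theta> - \<pi> / (2r)\<close>.
\<close>

text \<open>This is the binomial theorem for \<open>(cis x + cis (- x)) ^ d\<close>, whose base is
  \<open>2 * cos x\<close>; taking real parts turns each term into a cosine.\<close>

lemma cos_power_expansion:
  fixes x :: real
  shows "cos x ^ d = (\<Sum>j\<le>d. real (d choose j) * cos ((2 * real j - real d) * x)) / 2 ^ d"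
proof -
  have "complex_of_real ((2 * cos x) ^ d) = (cis x + cis (- x)) ^ d"
    by (simp add: complex_eq_iff flip: of_real_power)
  also have "\<dots> = (\<Sum>j\<le>d. of_nat (d choose j) * cis x ^ j * cis (- x) ^ (d - j))"
    by (rule binomial_ring)
  also have "\<dots> = (\<Sum>j\<le>d. of_real (real (d choose j)) * cis ((2 * real j - real d) * x))"
  proof (rule sum.cong, simp)
    fix j assume "j \<in> {..d}"
    then have "real j * x + real (d - j) * (- x) = (2 * real j - real d) * x"
      by (simp add: of_nat_diff algebra_simps)
    then have "cis x ^ j * cis (- x) ^ (d - j) = cis ((2 * real j - real d) * x)"
      by (simp only: Complex.DeMoivre cis_mult)
    then show "of_nat (d choose j) * cis x ^ j * cis (- x) ^ (d - j)
        = of_real (real (d choose j)) * cis ((2 * real j - real d) * x)"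
      by (simp add: mult.assoc)
  qed
  finally have "Re (complex_of_real ((2 * cos x) ^ d))
      = Re (\<Sum>j\<le>d. of_real (real (d choose j)) * cis ((2 * real j - real d) * x))"
    by (rule arg_cong)
  then have "(2 * cos x) ^ d = (\<Sum>j\<le>d. real (d choose j) * cos ((2 * real j - real d) * x))"
    by (simp only: Re_sum times_complex.sel Re_complex_of_real Im_complex_of_real cis.sel) simp
  then show ?thesis
    by (simp add: power_mult_distrib field_simps)
qed

text \<open>The base is an \<open>r\<close>-th root of unity and equals 1 exactly when
  \<open>r\<close> divides \<open>s\<close>. Otherwise the geometric sum has numerator
  \<open>?z ^ r - 1 = 0\<close>.\<close>

lemma sum_powers_root_of_unity:
  assumes "r > 0"
  shows "(\<Sum>k<r. cis (2 * pi * of_int s / real r) ^ k) = (if int r dvd s then of_nat r else 0)"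
proof (cases "int r dvd s")
  case True
  then obtain t where "s = int r * t" ..
  then have "2 * pi * of_int s / real r = 2 * pi * of_int t"
    using assms by simp
  then have "cis (2 * pi * of_int s / real r) = 1"
    by (simp only: cis_multiple_2pi Ints_of_int)
  then show ?thesis
    using True by simp
next
  case False
  let ?z = "cis (2 * pi * of_int s / real r)"
  have "?z \<noteq> 1"
  proof
    assume "?z = 1"
    then have "cos (2 * pi * of_int s / real r) = 1"
      by (simp add: complex_eq_iff)
    then obtain n :: int where "2 * pi * of_int s / real r = of_int n * 2 * pi"
      by (auto simp: cos_one_2pi_int)
    then have "real_of_int s = of_int (int r * n)"
      using assms by (simp add: field_simps)
    then have "s = int r * n"
      by (simp only: of_int_eq_iff)
    then show False
      using False by simp
  qed
  moreover have "?z ^ r = 1"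
    using assms by (simp add: Complex.DeMoivre)
  ultimately show ?thesis
    using False by (simp add: geometric_sum)
qed

text \<open>With the frequency written as \<open>2 * s - r\<close>, translating by
  \<open>k * pi / r\<close> changes the phase by \<open>k * pi\<close> minus
  \<open>2 * pi * k * s / r\<close>. The half turns cancel the alternating sign, and what remains is
  the \<open>k\<close>-th power of a root of unity.\<close>

lemma alternating_sum_cos_translates:
  fixes \<theta> :: real
  assumes "r > 0"
  shows "(\<Sum>k<r. (- 1) ^ k * cos ((2 * of_int s - real r) * (\<theta> - real k * pi / real r)))
    = (if int r dvd s then real r * cos ((2 * of_int s - real r) * \<theta>) else 0)"
proof -
  let ?m = "2 * of_int s - real r"
  let ?z = "cis (2 * pi * of_int (- s) / real r)"
  have "(- 1) ^ k * cos (?m * (\<theta> - real k * pi / real r)) = Re (cis (?m * \<theta>) * ?z ^ k)" for k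
  proof -
    let ?y = "?m * \<theta> + real k * (2 * pi * of_int (- s) / real r)"
    have "?m * (\<theta> - real k * pi / real r) = ?y + real k * pi"
      using assms by (simp add: field_simps)
    then have "cos (?m * (\<theta> - real k * pi / real r)) = (- 1) ^ k * cos ?y"
      by (simp only: cos_add cos_npi sin_npi) simp
    moreover have "cis (?m * \<theta>) * ?z ^ k = cis ?y"
      by (simp only: Complex.DeMoivre cis_mult)
    ultimately show ?thesis
      by (simp flip: mult.assoc power_mult_distrib)
  qed
  then have "(\<Sum>k<r. (- 1) ^ k * cos (?m * (\<theta> - real k * pi / real r)))
      = Re (cis (?m * \<theta>) * (\<Sum>k<r. ?z ^ k))"
    by (simp only: Re_sum sum_distrib_left)
  also have "\<dots> = (if int r dvd s then real r * cos (?m * \<theta>) else 0)"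
    unfolding sum_powers_root_of_unity[OF assms] by simp
  finally show ?thesis .
qed

text \<open>The parameter \<open>q\<close> stands for \<open>(d - r) / 2\<close>: the parity
  condition is built into \<open>d = 2 * q + r\<close>, and \<open>d < 3 * r\<close> becomes
  \<open>q < r\<close>.\<close>

lemma alternating_sum_cos_power:
  fixes \<theta> :: real
  assumes "q < r"
  defines "d \<equiv> 2 * q + r"
  shows "cos (real r * \<theta>) = 2 ^ (d - 1) / (real r * real (d choose q)) *
    (\<Sum>k<r. (- 1) ^ k * cos (\<theta> - real k * pi / real r) ^ d)"
proof -
  have r: "r > 0"
    using assms by simp
  let ?x = "\<lambda>k. \<theta> - real k * pi / real r"
  \<comment> \<open>Every frequency of the expansion takes the form \<open>2 * s - r\<close> with
    \<open>s = j - q\<close>, so it survives exactly when \<open>r\<close> divides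
    \<open>j - q\<close>.\<close>
  have freq: "2 * real j - real d = 2 * of_int (int j - int q) - real r" for j
    by (simp add: d_def)
  have "(\<Sum>k<r. (- 1) ^ k * cos (?x k) ^ d)
      = (\<Sum>k<r. \<Sum>j\<le>d. real (d choose j) / 2 ^ d * ((- 1) ^ k * cos ((2 * real j - real d) * ?x k)))"
    by (simp add: cos_power_expansion[of _ d] sum_distrib_left sum_divide_distrib mult_ac)
  also have "\<dots> = (\<Sum>j\<le>d. real (d choose j) / 2 ^ d *
      (\<Sum>k<r. (- 1) ^ k * cos ((2 * real j - real d) * ?x k)))"
    by (subst sum.swap) (simp only: sum_distrib_left)
  also have "\<dots> = (\<Sum>j\<le>d. real (d choose j) / 2 ^ d *
      (if int r dvd int j - int q then real r * cos ((2 * real j - real d) * \<theta>) else 0))"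
    unfolding freq alternating_sum_cos_translates[OF r] ..
  also have "\<dots> = (\<Sum>j\<in>{q, q + r}. real (d choose j) / 2 ^ d * (real r * cos ((2 * real j - real d) * \<theta>)))"
  proof (rule sum.mono_neutral_cong_right)
    show "\<forall>j\<in>{..d} - {q, q + r}. real (d choose j) / 2 ^ d *
      (if int r dvd int j - int q then real r * cos ((2 * real j - real d) * \<theta>) else 0) = 0"
    proof
      fix j assume j: "j \<in> {..d} - {q, q + r}"
      have "\<not> int r dvd int j - int q"
      proof
        assume "int r dvd int j - int q"
        then obtain t where t: "int j - int q = int r * t" ..
        \<comment> \<open>Since \<open>j\<close> runs from 0 to \<open>2 * q + r\<close>,
          \<open>j - q\<close> lies between \<open>- q\<close> and \<open>q + r\<close>, hence by
          \<open>q < r\<close> strictly between \<open>- r\<close> and \<open>2 * r\<close>. The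
          only multiples of \<open>r\<close> there are 0 and \<open>r\<close>, which give the two
          excluded indices.\<close>
        have "int r * (- 1) < int r * t" "int r * t < int r * 2"
          using j assms(1) unfolding t[symmetric] d_def by auto
        then have "t = 0 \<or> t = 1"
          using r by (simp only: mult_less_cancel_left) auto
        then show False
          using j t by auto
      qed
      then show "real (d choose j) / 2 ^ d *
        (if int r dvd int j - int q then real r * cos ((2 * real j - real d) * \<theta>) else 0) = 0"
        by simp
    qed
  qed (auto simp: d_def)
  also have "\<dots> = real r * real (d choose q) * (2 * cos (real r * \<theta>)) / 2 ^ d"
  proof -
    \<comment> \<open>As \<open>q + r = d - q\<close>, the two surviving terms have equal
      coefficients; their frequencies are opposite and cosine is even, hence the factor 2.\<close>
    have "d choose (q + r) = d choose q"
      using binomial_symmetric[of q d] by (simp add: d_def mult_2)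
    moreover have "2 * real q - real d = - real r" "2 * real (q + r) - real d = real r"
      by (simp_all add: d_def)
    ultimately show ?thesis
      using r by (simp del: of_nat_add)
  qed
  finally have sum_eq: "(\<Sum>k<r. (- 1) ^ k * cos (?x k) ^ d)
      = real r * real (d choose q) * (2 * cos (real r * \<theta>)) / 2 ^ d" .
  \<comment> \<open>This factor 2 absorbs the one from the two equal terms; \<open>r > 0\<close>
    makes \<open>d\<close> positive, so \<open>d - 1\<close> is not truncated.\<close>
  have "(2::real) ^ d = 2 * 2 ^ (d - 1)"
    using r by (cases d) (simp_all add: d_def)
  moreover have "d choose q > 0"
    by (simp add: d_def)
  ultimately show ?thesis
    unfolding sum_eq using r by (simp add: field_simps)
qed

lemma multiple_angle_formulas:
  fixes \<theta> :: real
  assumes "real d / 3 < real r" "r \<le> d" "even (d - r)"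
  defines "c \<equiv> 2 ^ (d - 1) / (real r * real (d choose ((d - r) div 2)))"
  shows "cos (real r * \<theta>) = c * (\<Sum>k = 0..r - 1. (- 1) ^ k * cos (\<theta> - real k * pi / real r) ^ d)"
    and "sin (real r * \<theta>) =
      c * (\<Sum>k = 0..r - 1. (- 1) ^ k * cos (\<theta> - (2 * real k + 1) / (2 * real r) * pi) ^ d)"
proof -
  define q where "q = (d - r) div 2"
  have d: "d = 2 * q + r"
    using assms(2,3) by (simp add: q_def)
  have q: "q < r"
    using assms(1) unfolding d by simp
  then have r: "r > 0"
    by simp
  \<comment> \<open>Positivity of \<open>r\<close> matters: at 0 the right-hand interval would be
    \<open>{0}\<close>.\<close>
  have range: "{..<r} = {0..r - 1}"
    using r by auto
  have *: "cos (real r * x) = c * (\<Sum>k = 0..r - 1. (- 1) ^ k * cos (x - real k * pi / real r) ^ d)" for x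
    using alternating_sum_cos_power[OF q, of x] unfolding range c_def q_def[symmetric] d[symmetric] .
  show "cos (real r * \<theta>) = c * (\<Sum>k = 0..r - 1. (- 1) ^ k * cos (\<theta> - real k * pi / real r) ^ d)"
    by (rule *)
  \<comment> \<open>The shift is chosen to lower the angle \<open>r * \<theta>\<close> by a quarter
    turn, which turns cosine into sine.\<close>
  have "real r * (\<theta> - pi / (2 * real r)) = real r * \<theta> - pi / 2"
    using r by (simp add: field_simps)
  then have "sin (real r * \<theta>) = cos (real r * (\<theta> - pi / (2 * real r)))"
    by (simp add: cos_diff)
  moreover have "\<theta> - pi / (2 * real r) - real k * pi / real r
      = \<theta> - (2 * real k + 1) / (2 * real r) * pi" for k
    using r by (simp add: field_simps)
  ultimately show "sin (real r * \<theta>) =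
      c * (\<Sum>k = 0..r - 1. (- 1) ^ k * cos (\<theta> - (2 * real k + 1) / (2 * real r) * pi) ^ d)"
    by (simp only: *)
qed

theorem proposition8p3:
  fixes d :: nat
  assumes "d > 0"
  shows "(\<forall>\<theta>::real.
            cos (real d * \<theta>) =
              2 ^ (d - 1) / real d * (\<Sum>k = 0..d - 1. (- 1) ^ k * cos (\<theta> - real k * pi / real d) ^ d)
          \<and> sin (real d * \<theta>) =
              2 ^ (d - 1) / real d *
                (\<Sum>k = 0..d - 1. (- 1) ^ k * cos (\<theta> - (2 * real k + 1) / (2 * real d) * pi) ^ d))
       \<and> (\<forall>r::nat. real d / 3 < real r \<and> r \<le> d \<and> even (d - r) \<longrightarrow>
          (\<forall>\<theta>::real.
            cos (real r * \<theta>) =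
              2 ^ (d - 1) / (real r * real (d choose ((d - r) div 2))) *
                (\<Sum>k = 0..r - 1. (- 1) ^ k * cos (\<theta> - real k * pi / real r) ^ d)
          \<and> sin (real r * \<theta>) =
              2 ^ (d - 1) / (real r * real (d choose ((d - r) div 2))) *
                (\<Sum>k = 0..r - 1. (- 1) ^ k * cos (\<theta> - (2 * real k + 1) / (2 * real r) * pi) ^ d)))"
proof (intro conjI allI impI; (elim conjE)?)
  fix \<theta> :: real
  \<comment> \<open>The first pair of formulas is the case \<open>r = d\<close>, where the binomial
    coefficient is \<open>d choose 0 = 1\<close>.\<close>
  have d: "real d / 3 < real d" "d \<le> d" "even (d - d)"
    using assms by simp_all
  show "cos (real d * \<theta>) =
      2 ^ (d - 1) / real d * (\<Sum>k = 0..d - 1. (- 1) ^ k * cos (\<theta> - real k * pi / real d) ^ d)"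
    using multiple_angle_formulas(1)[OF d, of \<theta>] by simp
  show "sin (real d * \<theta>) =
      2 ^ (d - 1) / real d *
        (\<Sum>k = 0..d - 1. (- 1) ^ k * cos (\<theta> - (2 * real k + 1) / (2 * real d) * pi) ^ d)"
    using multiple_angle_formulas(2)[OF d, of \<theta>] by simp
qed (rule multiple_angle_formulas; assumption)+

end
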